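(* Let $k$ be an algebraically closed field of characteristic zero, and let $\phi : \mathfrak{ym}(3) \to \mathfrak{sl}(2,k)$ be any morphism of Lie algebras over $k$, where $\mathfrak{ym}(3)$ is the Yang-Mills algebra on $3$ generators. Then the image of $\phi$ is a solvable Lie subalgebra of $\mathfrak{sl}(2,k)$.
   Context: Let $\mathfrak{f}(x_1,x_2,x_3)$ be the free Lie algebra over $k$ on generators $x_1,x_2,x_3$. The Yang-Mills algebra on $3$ generators is the quotient Lie algebra $$\mathfrak{ym}(3) = \mathfrak{f}(x_1,x_2,x_3)\big/\big\langle \textstyle\sum_{i=1}^3 [x_i,[x_i,x_j]] : 1 \leq j \leq 3 \big\rangle,$$ where $\langle\,\cdot\,\rangle$ denotes the Lie ideal generated by the given elements. *)

theory Defs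
  imports "HOL-Analysis.Analysis"
begin

section \<open>Lie algebras over a field\<close>

locale lie_algebra = vector_space scale
  for scale :: "'k::field \<Rightarrow> 'a::ab_group_add \<Rightarrow> 'a" +
  fixes bracket :: "'a \<Rightarrow> 'a \<Rightarrow> 'a"
  assumes bracket_add_left: "bracket (x + y) z = bracket x z + bracket y z"
    and bracket_add_right: "bracket x (y + z) = bracket x y + bracket x z"
    and bracket_scale_left: "bracket (scale c x) y = scale c (bracket x y)"
    and bracket_scale_right: "bracket x (scale c y) = scale c (bracket x y)"
    and bracket_self: "bracket x x = 0"
    and jacobi: "bracket x (bracket y z) + bracket y (bracket z x) + bracket z (bracket x y) = 0"
begin

definition lie_subalgebra :: "'a set \<Rightarrow> bool" where
  "lie_subalgebra S \<longleftrightarrow> subspace S \<and> (\<forall>x\<in>S. \<forall>y\<in>S. bracket x y \<in> S)"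

definition lie_ideal :: "'a set \<Rightarrow> bool" where
  "lie_ideal I \<longleftrightarrow> subspace I \<and> (\<forall>x. \<forall>y\<in>I. bracket x y \<in> I)"

definition lie_ideal_generated :: "'a set \<Rightarrow> 'a set" where
  "lie_ideal_generated A = \<Inter>{I. lie_ideal I \<and> A \<subseteq> I}"

definition derived_algebra :: "'a set \<Rightarrow> 'a set" where
  "derived_algebra S = span {bracket x y | x y. x \<in> S \<and> y \<in> S}"

definition lie_solvable :: "'a set \<Rightarrow> bool" where
  "lie_solvable S \<longleftrightarrow> (\<exists>n. (derived_algebra ^^ n) S = {0})"

lemma bracket_0_left [simp]: "bracket 0 x = 0"
  using bracket_add_left[of 0 0 x] by simp

lemma bracket_0_right [simp]: "bracket x 0 = 0"
  using bracket_add_right[of x 0 0] by simp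

lemma bracket_minus_left: "bracket (- x) y = - bracket x y"
  using bracket_add_left[of "- x" x y] by (simp add: eq_neg_iff_add_eq_0)

lemma bracket_minus_right: "bracket x (- y) = - bracket x y"
  using bracket_add_right[of x "- y" y] by (simp add: eq_neg_iff_add_eq_0)

lemma bracket_diff_left: "bracket (x - y) z = bracket x z - bracket y z"
  using bracket_add_left[of x "- y" z] by (simp add: bracket_minus_left)

lemma bracket_diff_right: "bracket x (y - z) = bracket x y - bracket x z"
  using bracket_add_right[of x y "- z"] by (simp add: bracket_minus_right)

lemma bracket_commute: "bracket x y = - bracket y x"
proof -
  have "bracket x y + bracket y x = bracket x (x + y) + bracket y (x + y)"
    by (simp add: bracket_add_right bracket_self)
  also have "\<dots> = 0"
    by (simp only: bracket_self flip: bracket_add_left)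
  finally show ?thesis
    by (simp add: eq_neg_iff_add_eq_0)
qed

lemma lie_ideal_lie_ideal_generated: "lie_ideal (lie_ideal_generated A)"
  unfolding lie_ideal_generated_def lie_ideal_def subspace_def by blast

lemma lie_ideal_generated_superset: "A \<subseteq> lie_ideal_generated A"
  unfolding lie_ideal_generated_def by blast

lemma lie_ideal_generated_least: "lie_ideal I \<Longrightarrow> A \<subseteq> I \<Longrightarrow> lie_ideal_generated A \<subseteq> I"
  unfolding lie_ideal_generated_def by blast

lemma lie_ideal_bracket_left: "lie_ideal I \<Longrightarrow> x \<in> I \<Longrightarrow> bracket x y \<in> I"
  unfolding lie_ideal_def by (metis bracket_commute subspace_neg)

end

locale lie_algebra_hom =
  source: lie_algebra scale1 bracket1 + target: lie_algebra scale2 bracket2 +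
  Vector_Spaces.linear scale1 scale2 f
  for scale1 :: "'k::field \<Rightarrow> 'a::ab_group_add \<Rightarrow> 'a" and bracket1
    and scale2 :: "'k \<Rightarrow> 'b::ab_group_add \<Rightarrow> 'b" and bracket2
    and f :: "'a \<Rightarrow> 'b" +
  assumes hom_bracket: "f (bracket1 x y) = bracket2 (f x) (f y)"


section \<open>The free Lie algebra\<close>

text \<open>
  The free Lie algebra on a set of generators is the algebra of formal Lie expressions modulo
  the least congruence that makes it a Lie algebra. Negation is scaling by \<open>-1\<close>.
\<close>

datatype ('k, 'x) lie_term =
    Gen 'x
  | Zero
  | Add "('k, 'x) lie_term" "('k, 'x) lie_term"
  | Scale 'k "('k, 'x) lie_term"
  | Bracket "('k, 'x) lie_term" "('k, 'x) lie_term"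

inductive lie_cong :: "('k::field, 'x) lie_term \<Rightarrow> ('k, 'x) lie_term \<Rightarrow> bool" where
  cong_refl: "lie_cong a a"
| cong_sym: "lie_cong a b \<Longrightarrow> lie_cong b a"
| cong_trans: "lie_cong a b \<Longrightarrow> lie_cong b c \<Longrightarrow> lie_cong a c"
| cong_Add: "lie_cong a a' \<Longrightarrow> lie_cong b b' \<Longrightarrow> lie_cong (Add a b) (Add a' b')"
| cong_Scale: "lie_cong a a' \<Longrightarrow> lie_cong (Scale r a) (Scale r a')"
| cong_Bracket: "lie_cong a a' \<Longrightarrow> lie_cong b b' \<Longrightarrow> lie_cong (Bracket a b) (Bracket a' b')"
| cong_add_assoc: "lie_cong (Add (Add a b) c) (Add a (Add b c))"
| cong_add_commute: "lie_cong (Add a b) (Add b a)"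
| cong_add_zero: "lie_cong (Add Zero a) a"
| cong_add_neg: "lie_cong (Add (Scale (-1) a) a) Zero"
| cong_scale_add_right: "lie_cong (Scale r (Add a b)) (Add (Scale r a) (Scale r b))"
| cong_scale_add_left: "lie_cong (Scale (r + s) a) (Add (Scale r a) (Scale s a))"
| cong_scale_scale: "lie_cong (Scale r (Scale s a)) (Scale (r * s) a)"
| cong_scale_one: "lie_cong (Scale 1 a) a"
| cong_bracket_add_left: "lie_cong (Bracket (Add a b) c) (Add (Bracket a c) (Bracket b c))"
| cong_bracket_add_right: "lie_cong (Bracket a (Add b c)) (Add (Bracket a b) (Bracket a c))"
| cong_bracket_scale_left: "lie_cong (Bracket (Scale r a) b) (Scale r (Bracket a b))"
| cong_bracket_scale_right: "lie_cong (Bracket a (Scale r b)) (Scale r (Bracket a b))"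
| cong_bracket_self: "lie_cong (Bracket a a) Zero"
| cong_jacobi: "lie_cong (Add (Add (Bracket a (Bracket b c)) (Bracket b (Bracket c a)))
                        (Bracket c (Bracket a b))) Zero"

quotient_type (overloaded) ('k, 'x) free_lie = "('k::field, 'x) lie_term" / lie_cong
  by (intro equivpI reflpI sympI transpI) (blast intro: cong_refl cong_sym cong_trans)+

instantiation free_lie :: (field, type) ab_group_add
begin

lift_definition zero_free_lie :: "('a, 'b) free_lie" is Zero .

lift_definition plus_free_lie :: "('a, 'b) free_lie \<Rightarrow> ('a, 'b) free_lie \<Rightarrow> ('a, 'b) free_lie"
  is Add by (rule cong_Add)

lift_definition uminus_free_lie :: "('a, 'b) free_lie \<Rightarrow> ('a, 'b) free_lie"
  is "Scale (-1)" by (rule cong_Scale)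

definition minus_free_lie :: "('a, 'b) free_lie \<Rightarrow> ('a, 'b) free_lie \<Rightarrow> ('a, 'b) free_lie"
  where "minus_free_lie a b = a + - b"

instance
proof
  fix a b c :: "('a, 'b) free_lie"
  show "a + b + c = a + (b + c)"
    by transfer (rule cong_add_assoc)
  show "a + b = b + a"
    by transfer (rule cong_add_commute)
  show "0 + a = a"
    by transfer (rule cong_add_zero)
  show "- a + a = 0"
    by transfer (rule cong_add_neg)
qed (rule minus_free_lie_def)

end

lift_definition gen :: "'x \<Rightarrow> ('k::field, 'x) free_lie" is Gen .

lift_definition scale_free :: "'k::field \<Rightarrow> ('k, 'x) free_lie \<Rightarrow> ('k, 'x) free_lie"
  is Scale by (rule cong_Scale)

lift_definition bracket_free ::
    "('k::field, 'x) free_lie \<Rightarrow> ('k, 'x) free_lie \<Rightarrow> ('k, 'x) free_lie"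
  is Bracket by (rule cong_Bracket)

interpretation free_lie: lie_algebra "scale_free :: 'k::field \<Rightarrow> ('k, 'x) free_lie \<Rightarrow> _" bracket_free
proof unfold_locales
  fix c d :: 'k and x y z :: "('k, 'x) free_lie"
  show "scale_free c (x + y) = scale_free c x + scale_free c y"
    by transfer (rule cong_scale_add_right)
  show "scale_free (c + d) x = scale_free c x + scale_free d x"
    by transfer (rule cong_scale_add_left)
  show "scale_free c (scale_free d x) = scale_free (c * d) x"
    by transfer (rule cong_scale_scale)
  show "scale_free 1 x = x"
    by transfer (rule cong_scale_one)
  show "bracket_free (x + y) z = bracket_free x z + bracket_free y z"
    by transfer (rule cong_bracket_add_left)
  show "bracket_free x (y + z) = bracket_free x y + bracket_free x z"
    by transfer (rule cong_bracket_add_right)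
  show "bracket_free (scale_free c x) y = scale_free c (bracket_free x y)"
    by transfer (rule cong_bracket_scale_left)
  show "bracket_free x (scale_free c y) = scale_free c (bracket_free x y)"
    by transfer (rule cong_bracket_scale_right)
  show "bracket_free x x = 0"
    by transfer (rule cong_bracket_self)
  show "bracket_free x (bracket_free y z) + bracket_free y (bracket_free z x)
      + bracket_free z (bracket_free x y) = 0"
    by transfer (rule cong_jacobi)
qed

context lie_algebra
begin

primrec eval_lie :: "('x \<Rightarrow> 'a) \<Rightarrow> ('k, 'x) lie_term \<Rightarrow> 'a" where
  "eval_lie g (Gen x) = g x"
| "eval_lie g Zero = 0"
| "eval_lie g (Add a b) = eval_lie g a + eval_lie g b"
| "eval_lie g (Scale r a) = scale r (eval_lie g a)"
| "eval_lie g (Bracket a b) = bracket (eval_lie g a) (eval_lie g b)"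

lemma eval_lie_cong: "lie_cong a b \<Longrightarrow> eval_lie g a = eval_lie g b"
  by (induction rule: lie_cong.induct)
    (simp_all add: scale_right_distrib scale_left_distrib bracket_add_left bracket_add_right
      bracket_scale_left bracket_scale_right bracket_self jacobi jacobi[unfolded add.assoc] ac_simps
      del: add_uminus_conv_diff)

end

theorem free_lie_universal:
  fixes scale :: "'k::field \<Rightarrow> 'a::ab_group_add \<Rightarrow> 'a" and g :: "'x \<Rightarrow> 'a"
  assumes "lie_algebra scale bracket"
  shows "\<exists>!f. lie_algebra_hom scale_free bracket_free scale bracket f \<and> (\<forall>x. f (gen x) = g x)"
proof -
  interpret L: lie_algebra scale bracket by fact
  define F where "F a = L.eval_lie g (rep_free_lie a)" for a :: "('k, 'x) free_lie"
  have F_abs: "F (abs_free_lie t) = L.eval_lie g t" for t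
    unfolding F_def
    by (rule L.eval_lie_cong, rule Quotient3_rep_abs[OF Quotient3_free_lie]) (rule cong_refl)
  have F_hom: "F (a + b) = F a + F b" "F (scale_free r a) = scale r (F a)"
      "F (bracket_free a b) = bracket (F a) (F b)" for a b r
    by (induction a rule: free_lie.abs_induct, induction b rule: free_lie.abs_induct,
        simp add: F_abs plus_free_lie.abs_eq scale_free.abs_eq bracket_free.abs_eq)+
  have F_gen: "F (gen x) = g x" for x
    by (simp add: gen.abs_eq F_abs)
  show ?thesis
  proof (rule ex1I[of _ F])
    show "lie_algebra_hom scale_free bracket_free scale bracket F \<and> (\<forall>x. F (gen x) = g x)"
      by (intro conjI allI F_gen, unfold_locales) (simp_all add: F_hom)
  next
    fix f assume f: "lie_algebra_hom scale_free bracket_free scale bracket f \<and> (\<forall>x. f (gen x) = g x)"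
    then interpret f: lie_algebra_hom scale_free bracket_free scale bracket f by blast
    have "f (abs_free_lie t) = L.eval_lie g t" for t
      using f.zero f.add f.scale f.hom_bracket f
      by (induction t)
        (simp_all flip: gen.abs_eq zero_free_lie.abs_eq plus_free_lie.abs_eq scale_free.abs_eq
          bracket_free.abs_eq)
    then have "f a = F a" for a
      by (induction a rule: free_lie.abs_induct) (simp add: F_abs)
    then show "f = F" ..
  qed
qed


section \<open>The Yang-Mills algebra\<close>

text \<open>The generators are indexed by a finite type; \<open>ym(n)\<close> has an index type with \<open>n\<close> elements.\<close>

definition yang_mills_relations :: "('k::field, 'n::finite) free_lie set" where
  "yang_mills_relations =
     range (\<lambda>j. \<Sum>i\<in>UNIV. bracket_free (gen i) (bracket_free (gen i) (gen j)))"

definition yang_mills_cong :: "('k::field, 'n::finite) free_lie \<Rightarrow> ('k, 'n) free_lie \<Rightarrow> bool" where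
  "yang_mills_cong a b \<longleftrightarrow> a - b \<in> free_lie.lie_ideal_generated yang_mills_relations"

lemma subspace_yang_mills_ideal:
  "free_lie.subspace (free_lie.lie_ideal_generated yang_mills_relations)"
  using free_lie.lie_ideal_lie_ideal_generated unfolding free_lie.lie_ideal_def by blast

lemma yang_mills_cong_refl: "a = b \<Longrightarrow> yang_mills_cong a b"
  using free_lie.subspace_0[OF subspace_yang_mills_ideal] by (simp add: yang_mills_cong_def)

quotient_type (overloaded) ('k, 'n) yang_mills = "('k::field, 'n::finite) free_lie" / yang_mills_cong
proof (intro equivpI reflpI sympI transpI)
  fix a b c :: "('k, 'n) free_lie"
  show "yang_mills_cong a a"
    by (rule yang_mills_cong_refl) (rule refl)
  show "yang_mills_cong b a" if "yang_mills_cong a b"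
    using free_lie.subspace_neg[OF subspace_yang_mills_ideal that[unfolded yang_mills_cong_def]]
    by (simp add: yang_mills_cong_def)
  show "yang_mills_cong a c" if "yang_mills_cong a b" "yang_mills_cong b c"
    using free_lie.subspace_add[OF subspace_yang_mills_ideal that[unfolded yang_mills_cong_def]]
    by (simp add: yang_mills_cong_def)
qed

instantiation yang_mills :: (field, finite) ab_group_add
begin

lift_definition zero_yang_mills :: "('a, 'b) yang_mills" is 0 .

lift_definition plus_yang_mills ::
    "('a, 'b) yang_mills \<Rightarrow> ('a, 'b) yang_mills \<Rightarrow> ('a, 'b) yang_mills" is "(+)"
  unfolding yang_mills_cong_def add_diff_add
  by (rule free_lie.subspace_add[OF subspace_yang_mills_ideal])

lift_definition uminus_yang_mills :: "('a, 'b) yang_mills \<Rightarrow> ('a, 'b) yang_mills" is uminus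
  unfolding yang_mills_cong_def minus_diff_minus
  by (rule free_lie.subspace_neg[OF subspace_yang_mills_ideal])

definition minus_yang_mills ::
    "('a, 'b) yang_mills \<Rightarrow> ('a, 'b) yang_mills \<Rightarrow> ('a, 'b) yang_mills"
  where "minus_yang_mills a b = a + - b"

instance
proof
  fix a b c :: "('a, 'b) yang_mills"
  show "a + b + c = a + (b + c)"
    by transfer (rule yang_mills_cong_refl, rule add.assoc)
  show "a + b = b + a"
    by transfer (rule yang_mills_cong_refl, rule add.commute)
  show "0 + a = a"
    by transfer (rule yang_mills_cong_refl, rule add_0_left)
  show "- a + a = 0"
    by transfer (rule yang_mills_cong_refl, rule left_minus)
qed (rule minus_yang_mills_def)

end

lift_definition scale_ym :: "'k::field \<Rightarrow> ('k, 'n::finite) yang_mills \<Rightarrow> ('k, 'n) yang_mills"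
  is scale_free
  unfolding yang_mills_cong_def free_lie.scale_right_diff_distrib[symmetric]
  by (rule free_lie.subspace_scale[OF subspace_yang_mills_ideal])

lift_definition bracket_ym ::
    "('k::field, 'n::finite) yang_mills \<Rightarrow> ('k, 'n) yang_mills \<Rightarrow> ('k, 'n) yang_mills"
  is bracket_free
proof -
  let ?I = "free_lie.lie_ideal_generated yang_mills_relations :: ('k, 'n) free_lie set"
  fix a a' b b' :: "('k, 'n) free_lie"
  assume a: "yang_mills_cong a a'" and b: "yang_mills_cong b b'"
  have "bracket_free (a - a') b \<in> ?I"
    using a unfolding yang_mills_cong_def
    by (rule free_lie.lie_ideal_bracket_left[OF free_lie.lie_ideal_lie_ideal_generated])
  moreover have "bracket_free a' (b - b') \<in> ?I"
    using b free_lie.lie_ideal_lie_ideal_generated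
    unfolding yang_mills_cong_def free_lie.lie_ideal_def by blast
  ultimately have "bracket_free (a - a') b + bracket_free a' (b - b') \<in> ?I"
    by (rule free_lie.subspace_add[OF subspace_yang_mills_ideal])
  then show "yang_mills_cong (bracket_free a b) (bracket_free a' b')"
    by (simp add: yang_mills_cong_def free_lie.bracket_diff_left free_lie.bracket_diff_right)
qed

interpretation yang_mills: lie_algebra "scale_ym :: 'k::field \<Rightarrow> ('k, 'n::finite) yang_mills \<Rightarrow> _" bracket_ym
proof unfold_locales
  fix c d :: 'k and x y z :: "('k, 'n) yang_mills"
  show "scale_ym c (x + y) = scale_ym c x + scale_ym c y"
    by transfer (rule yang_mills_cong_refl, rule free_lie.scale_right_distrib)
  show "scale_ym (c + d) x = scale_ym c x + scale_ym d x"
    by transfer (rule yang_mills_cong_refl, rule free_lie.scale_left_distrib)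
  show "scale_ym c (scale_ym d x) = scale_ym (c * d) x"
    by transfer (rule yang_mills_cong_refl, rule free_lie.scale_scale)
  show "scale_ym 1 x = x"
    by transfer (rule yang_mills_cong_refl, rule free_lie.scale_one)
  show "bracket_ym (x + y) z = bracket_ym x z + bracket_ym y z"
    by transfer (rule yang_mills_cong_refl, rule free_lie.bracket_add_left)
  show "bracket_ym x (y + z) = bracket_ym x y + bracket_ym x z"
    by transfer (rule yang_mills_cong_refl, rule free_lie.bracket_add_right)
  show "bracket_ym (scale_ym c x) y = scale_ym c (bracket_ym x y)"
    by transfer (rule yang_mills_cong_refl, rule free_lie.bracket_scale_left)
  show "bracket_ym x (scale_ym c y) = scale_ym c (bracket_ym x y)"
    by transfer (rule yang_mills_cong_refl, rule free_lie.bracket_scale_right)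
  show "bracket_ym x x = 0"
    by transfer (rule yang_mills_cong_refl, rule free_lie.bracket_self)
  show "bracket_ym x (bracket_ym y z) + bracket_ym y (bracket_ym z x)
      + bracket_ym z (bracket_ym x y) = 0"
    by transfer (rule yang_mills_cong_refl, rule free_lie.jacobi)
qed


section \<open>The special linear Lie algebra\<close>

typedef (overloaded) ('k, 'n) sl = "{A :: 'k::field ^ 'n ^ 'n::finite. trace A = 0}"
  by (rule exI[of _ 0]) (simp add: trace_def)

setup_lifting type_definition_sl

instantiation sl :: (field, finite) ab_group_add
begin

lift_definition zero_sl :: "('a, 'b) sl" is 0
  by (simp add: trace_def)

lift_definition plus_sl :: "('a, 'b) sl \<Rightarrow> ('a, 'b) sl \<Rightarrow> ('a, 'b) sl" is "(+)"
  by (simp add: trace_add)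

lift_definition uminus_sl :: "('a, 'b) sl \<Rightarrow> ('a, 'b) sl" is uminus
  by (simp add: trace_def sum_negf)

lift_definition minus_sl :: "('a, 'b) sl \<Rightarrow> ('a, 'b) sl \<Rightarrow> ('a, 'b) sl" is "(-)"
  by (simp add: trace_sub)

instance
proof
  fix a b c :: "('a, 'b) sl"
  show "a + b + c = a + (b + c)"
    by transfer (rule add.assoc)
  show "a + b = b + a"
    by transfer (rule add.commute)
  show "0 + a = a"
    by transfer (rule add_0_left)
  show "- a + a = 0"
    by transfer (rule left_minus)
  show "a - b = a + - b"
    by transfer (rule diff_conv_add_uminus)
qed

end

lift_definition scale_sl :: "'k::field \<Rightarrow> ('k, 'n::finite) sl \<Rightarrow> ('k, 'n) sl"
  is "\<lambda>c A. \<chi> i j. c * A $ i $ j"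
  by (simp add: trace_def sum_distrib_left[symmetric])

lift_definition bracket_sl :: "('k::field, 'n::finite) sl \<Rightarrow> ('k, 'n) sl \<Rightarrow> ('k, 'n) sl"
  is "\<lambda>A B. A ** B - B ** A"
  by (simp only: mem_Collect_eq trace_sub) (subst trace_mul_sym, rule diff_self)

interpretation sl: lie_algebra "scale_sl :: 'k::field \<Rightarrow> ('k, 'n::finite) sl \<Rightarrow> _" bracket_sl
proof unfold_locales
  fix c d :: 'k and x y z :: "('k, 'n) sl"
  show "scale_sl c (x + y) = scale_sl c x + scale_sl c y"
       "scale_sl (c + d) x = scale_sl c x + scale_sl d x"
       "scale_sl c (scale_sl d x) = scale_sl (c * d) x"
       "scale_sl 1 x = x"
    by (transfer, simp add: vec_eq_iff algebra_simps)+
  show "bracket_sl (x + y) z = bracket_sl x z + bracket_sl y z"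
       "bracket_sl x (y + z) = bracket_sl x y + bracket_sl x z"
       "bracket_sl (scale_sl c x) y = scale_sl c (bracket_sl x y)"
       "bracket_sl x (scale_sl c y) = scale_sl c (bracket_sl x y)"
    by (transfer, simp add: vec_eq_iff matrix_matrix_mult_def sum.distrib sum_distrib_left
          algebra_simps)+
  show "bracket_sl x x = 0"
    by transfer simp
  show "bracket_sl x (bracket_sl y z) + bracket_sl y (bracket_sl z x)
      + bracket_sl z (bracket_sl x y) = 0"
  proof transfer
    fix A B C :: "'k ^ 'n ^ 'n"
    have l: "A ** (B - C) = A ** B - A ** C" and r: "(A - B) ** C = A ** C - B ** C"
      for A B C :: "'k ^ 'n ^ 'n"
      by (simp_all add: vec_eq_iff matrix_matrix_mult_def sum_subtractf algebra_simps)
    show "A ** (B ** C - C ** B) - (B ** C - C ** B) ** A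
        + (B ** (C ** A - A ** C) - (C ** A - A ** C) ** B)
        + (C ** (A ** B - B ** A) - (A ** B - B ** A) ** C) = 0"
      by (simp add: l r matrix_mul_assoc)
  qed
qed

end

theory Submission
  imports Defs
begin

text \<open>
  On \<open>sl(2)\<close> the trace form \<open>B\<close> satisfies \<open>[x,[y,z]] = 2 B(x,y) z - 2 B(x,z) y\<close>, so images
  \<open>A\<^sub>1, A\<^sub>2, A\<^sub>3\<close> of the generators satisfy the Yang-Mills relations iff \<open>\<tau> A\<^sub>j = \<Sum>\<^sub>i g\<^sub>i\<^sub>j A\<^sub>i\<close>, where \<open>g\<close>
  is their Gram matrix and \<open>\<tau>\<close> its trace. If the \<open>A\<^sub>i\<close> commute, they lie on a line. Otherwise let
  \<open>x = [A\<^sub>p,A\<^sub>q] \<noteq> 0\<close>. Linear independence of the \<open>A\<^sub>i\<close> would force \<open>g = \<tau> I\<close>, hence \<open>\<tau> = 3 \<tau> = 0\<close> and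
  \<open>g = 0\<close>, which is impossible; so the \<open>A\<^sub>i\<close> span a plane, and comparing coefficients gives
  \<open>\<tau> = 2 \<tau> = 0\<close> and then \<open>B(x,x) = 0\<close>. The plane is thus the orthogonal complement of the isotropic
  vector \<open>x\<close>, a Borel subalgebra.
\<close>

section \<open>The trace form and bracket identities on \<open>sl(2)\<close>\<close>

lift_definition trace_form :: "('k::field, 'n::finite) sl \<Rightarrow> ('k, 'n) sl \<Rightarrow> 'k"
  is "\<lambda>A B. trace (A ** B)" .

lemma trace_form_commute: "trace_form x y = trace_form y x"
  by transfer (rule trace_mul_sym)

lemma trace_form_add_right: "trace_form x (y + z) = trace_form x y + trace_form x z"
  by transfer (simp add: matrix_add_ldistrib trace_add)

lemma trace_form_scale_right: "trace_form x (scale_sl c y) = c * trace_form x y"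
  by transfer (simp add: trace_def matrix_matrix_mult_def sum_distrib_left algebra_simps)

lemma trace_form_add_left: "trace_form (x + y) z = trace_form x z + trace_form y z"
  by (metis trace_form_add_right trace_form_commute)

lemma trace_form_scale_left: "trace_form (scale_sl c x) y = c * trace_form x y"
  by (metis trace_form_scale_right trace_form_commute)

lemma trace_form_0_right [simp]: "trace_form x 0 = 0"
  using trace_form_scale_right[of x 0 0] by simp

text \<open>Invariance of the form, a consequence of the cyclicity of the trace. It makes
  \<open>B([p,q],r)\<close> behave like a volume form in \<open>p\<close>, \<open>q\<close>,
  \<open>r\<close>.\<close>

lemma trace_form_bracket: "trace_form (bracket_sl x y) z = trace_form x (bracket_sl y z)"
proof transfer
  fix A B C :: "'a ^ 'b ^ 'b"
  have l: "A ** (B - C) = A ** B - A ** C" and r: "(A - B) ** C = A ** C - B ** C"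
    for A B C :: "'a ^ 'b ^ 'b"
    by (simp_all add: vec_eq_iff matrix_matrix_mult_def sum_subtractf algebra_simps)
  have "trace (B ** A ** C) = trace (A ** C ** B)"
    by (metis matrix_mul_assoc trace_mul_sym)
  then show "trace ((A ** B - B ** A) ** C) = trace (A ** (B ** C - C ** B))"
    by (simp add: l r trace_sub matrix_mul_assoc)
qed

text \<open>The analogue of the vector triple product identity. Vanishing traces eliminate the lower
  right entries, and what remains is a polynomial identity in the other three.\<close>

lemma sl2_double_bracket:
  fixes x y z :: "('k::field, 2) sl"
  shows "bracket_sl x (bracket_sl y z) =
    scale_sl (2 * trace_form x y) z - scale_sl (2 * trace_form x z) y"
proof transfer
  fix A B C :: "'k ^ 2 ^ 2"
  assume "trace A = 0" "trace B = 0" "trace C = 0"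
  then have "A $ 2 $ 2 = - A $ 1 $ 1" "B $ 2 $ 2 = - B $ 1 $ 1" "C $ 2 $ 2 = - C $ 1 $ 1"
    by (simp_all add: trace_def sum_2 add_eq_0_iff)
  then show "A ** (B ** C - C ** B) - (B ** C - C ** B) ** A =
      (\<chi> i j. 2 * trace (A ** B) * C $ i $ j) - (\<chi> i j. 2 * trace (A ** C) * B $ i $ j)"
    by (simp add: vec_eq_iff forall_2 matrix_matrix_mult_def trace_def sum_2 algebra_simps)
qed

text \<open>The entries of the commutator are, up to nonzero integer factors, the 2x2 minors of the
  coordinate vectors of \<open>x\<close> and \<open>w\<close>. If they vanish, the two vectors are
  proportional; characteristic zero allows cancelling the factor 2.\<close>

lemma sl2_centralizer:
  fixes x w :: "('k::field_char_0, 2) sl"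
  assumes "x \<noteq> 0" "bracket_sl x w = 0"
  shows "\<exists>c. w = scale_sl c x"
  using assms
proof transfer
  fix A B :: "'k ^ 2 ^ 2"
  assume "trace A = 0" "trace B = 0"
  then have tr: "A $ 2 $ 2 = - A $ 1 $ 1" "B $ 2 $ 2 = - B $ 1 $ 1"
    by (simp_all add: trace_def sum_2 add_eq_0_iff)
  assume nz: "A \<noteq> 0" and comm: "A ** B - B ** A = 0"
  have "(A ** B - B ** A) $ 1 $ 1 = A $ 1 $ 2 * B $ 2 $ 1 - B $ 1 $ 2 * A $ 2 $ 1"
    and "(A ** B - B ** A) $ 1 $ 2 = 2 * (A $ 1 $ 1 * B $ 1 $ 2 - B $ 1 $ 1 * A $ 1 $ 2)"
    and "(A ** B - B ** A) $ 2 $ 1 = - 2 * (A $ 1 $ 1 * B $ 2 $ 1 - B $ 1 $ 1 * A $ 2 $ 1)"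
    using tr by (simp_all add: matrix_matrix_mult_def sum_2 algebra_simps)
  then have e: "A $ 1 $ 2 * B $ 2 $ 1 = B $ 1 $ 2 * A $ 2 $ 1"
    "A $ 1 $ 1 * B $ 1 $ 2 = B $ 1 $ 1 * A $ 1 $ 2"
    "A $ 1 $ 1 * B $ 2 $ 1 = B $ 1 $ 1 * A $ 2 $ 1"
    unfolding comm by simp_all
  have proportional: "\<exists>c. B = (\<chi> i j. c * A $ i $ j)"
    if "\<And>i j. A $ k $ l * B $ i $ j = B $ k $ l * A $ i $ j" "A $ k $ l \<noteq> 0" for k l
    using that(1)[symmetric] that(2)
    by (intro exI[of _ "B $ k $ l / A $ k $ l"]) (simp add: vec_eq_iff)
  consider "A $ 1 $ 1 \<noteq> 0" | "A $ 1 $ 2 \<noteq> 0" | "A $ 2 $ 1 \<noteq> 0"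
    using nz tr by (auto simp: vec_eq_iff forall_2)
  then show "\<exists>c. B = (\<chi> i j. c * A $ i $ j)"
  proof cases
    case 1
    have "A $ 1 $ 1 * B $ i $ j = B $ 1 $ 1 * A $ i $ j" for i j
      using e tr exhaust_2[of i] exhaust_2[of j] by (auto simp: mult.commute)
    then show ?thesis by (rule proportional) (rule 1)
  next
    case 2
    have "A $ 1 $ 2 * B $ i $ j = B $ 1 $ 2 * A $ i $ j" for i j
      using e tr exhaust_2[of i] exhaust_2[of j] by (auto simp: mult.commute)
    then show ?thesis by (rule proportional) (rule 2)
  next
    case 3
    have "A $ 2 $ 1 * B $ i $ j = B $ 2 $ 1 * A $ i $ j" for i j
      using e tr exhaust_2[of i] exhaust_2[of j] by (auto simp: mult.commute)
    then show ?thesis by (rule proportional) (rule 3)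
  qed
qed

section \<open>Lines, orthogonal complements and solvability\<close>

lemma (in lie_algebra) lie_subalgebra_span_singleton: "lie_subalgebra (span {x})"
proof -
  have "bracket y z = 0" if "y \<in> span {x}" "z \<in> span {x}" for y z
    using that by (auto simp: span_singleton bracket_scale_left bracket_scale_right bracket_self)
  then show ?thesis
    by (simp add: lie_subalgebra_def span_zero)
qed

text \<open>The derived algebra lies in a line, which is abelian, so the second derived algebra is
  zero.\<close>

lemma (in lie_algebra) lie_solvable_if_brackets_in_line:
  assumes "\<And>y z. y \<in> S \<Longrightarrow> z \<in> S \<Longrightarrow> bracket y z \<in> span {x}"
  shows "lie_solvable S"
proof -
  let ?D = "derived_algebra S"
  have D: "?D \<subseteq> span {x}"
    unfolding derived_algebra_def by (rule span_minimal) (use assms in auto)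
  have "bracket y z = 0" if "y \<in> ?D" "z \<in> ?D" for y z
    using D[THEN subsetD, OF that(1)] D[THEN subsetD, OF that(2)]
    by (auto simp: span_singleton bracket_scale_left bracket_scale_right bracket_self)
  then have "{bracket y z |y z. y \<in> ?D \<and> z \<in> ?D} \<subseteq> {0}"
    by blast
  then have "derived_algebra ?D \<subseteq> {0}"
    unfolding derived_algebra_def[of ?D] by (rule span_minimal) (rule subspace_single_0)
  moreover have "0 \<in> derived_algebra ?D"
    unfolding derived_algebra_def[of ?D] by (rule span_zero)
  ultimately have "(derived_algebra ^^ 2) S = {0}"
    by (auto simp: numeral_2_eq_2)
  then show ?thesis
    unfolding lie_solvable_def by blast
qed

text \<open>By \<open>sl2_double_bracket\<close>, orthogonality makes \<open>[x,[y,z]]\<close>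
  vanish, so \<open>[y,z]\<close> centralizes \<open>x\<close>.\<close>

lemma sl2_bracket_in_line:
  fixes x :: "('k::field_char_0, 2) sl"
  assumes "x \<noteq> 0" "trace_form x y = 0" "trace_form x z = 0"
  shows "\<exists>c. bracket_sl y z = scale_sl c x"
  using assms by (intro sl2_centralizer) (simp_all add: sl2_double_bracket)

text \<open>Brackets of vectors orthogonal to \<open>x\<close> are multiples of \<open>x\<close>,
  and an isotropic \<open>x\<close> is orthogonal to itself.\<close>

lemma sl2_lie_subalgebra_orthogonal:
  fixes x :: "('k::field_char_0, 2) sl"
  assumes "x \<noteq> 0" "trace_form x x = 0"
  shows "sl.lie_subalgebra {y. trace_form x y = 0}"
proof -
  have "trace_form x (bracket_sl y z) = 0" if "trace_form x y = 0" "trace_form x z = 0" for y z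
    using sl2_bracket_in_line[OF assms(1) that] assms(2) by (auto simp: trace_form_scale_right)
  then show ?thesis
    by (auto simp: sl.lie_subalgebra_def sl.subspace_def trace_form_add_right trace_form_scale_right)
qed

section \<open>Noncommuting triples satisfying the Yang-Mills relations\<close>

locale sl2_yang_mills_triple =
  fixes p q r :: "('k::field_char_0, 2) sl"
  assumes rel_p: "bracket_sl q (bracket_sl q p) + bracket_sl r (bracket_sl r p) = 0"
    and rel_q: "bracket_sl p (bracket_sl p q) + bracket_sl r (bracket_sl r q) = 0"
    and rel_r: "bracket_sl p (bracket_sl p r) + bracket_sl q (bracket_sl q r) = 0"
    and noncommuting: "bracket_sl p q \<noteq> 0"
begin

abbreviation B where "B \<equiv> trace_form"

text \<open>Expanding both double brackets gives twice the claimed identity. The diagonal term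
  \<open>B u u\<close> is absent on both sides because \<open>[u,[u,u]] = 0\<close> does not occur
  in the relation.\<close>

lemma gram_relation:
  fixes u v w :: "('k, 2) sl"
  assumes "bracket_sl v (bracket_sl v u) + bracket_sl w (bracket_sl w u) = 0"
  shows "scale_sl (B v v + B w w) u = scale_sl (B v u) v + scale_sl (B w u) w"
proof -
  have "scale_sl 2 (scale_sl (B v v + B w w) u - (scale_sl (B v u) v + scale_sl (B w u) w)) = 0"
    using assms by (simp add: sl2_double_bracket sl.scale_right_diff_distrib
        sl.scale_right_distrib sl.scale_left_distrib algebra_simps)
  then show ?thesis
    by (simp only: sl.scale_eq_0_iff) simp
qed

lemmas gram_p = gram_relation[OF rel_p]
lemmas gram_q = gram_relation[OF rel_q]
lemmas gram_r = gram_relation[OF rel_r]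

text \<open>A nonzero volume \<open>d\<close> would make \<open>p\<close>, \<open>q\<close>,
  \<open>r\<close> independent. The relations would then kill enough of the Gram matrix to make
  \<open>p\<close> and \<open>q\<close> commute.\<close>

lemma third_orthogonal: "B (bracket_sl p q) r = 0"
proof (rule ccontr)
  let ?x = "bracket_sl p q" and ?y = "bracket_sl q r" and ?z = "bracket_sl r p"
  define d where "d = B ?x r"
  assume "B ?x r \<noteq> 0"
  then have d: "d \<noteq> 0" by (simp add: d_def)
  \<comment> \<open>Up to the factor \<open>d\<close>, the vectors \<open>?y\<close>,
    \<open>?z\<close>, \<open>?x\<close> are dual to \<open>p\<close>, \<open>q\<close>,
    \<open>r\<close>; pairing with them reads off coefficients in the Gram relations.\<close>
  have form: "B ?x p = 0" "B ?x q = 0" "B ?x r = d" "B ?y p = d" "B ?y q = 0" "B ?y r = 0"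
      "B ?z p = 0" "B ?z q = d" "B ?z r = 0"
    unfolding d_def
    by (metis sl.bracket_self trace_form_0_right trace_form_bracket trace_form_commute)+
  note lin = trace_form_add_right trace_form_scale_right
  have off: "B q p = 0" "B r p = 0" "B r q = 0" "B q q + B r r = 0" "B p p + B r r = 0"
      "B p p + B q q = 0"
    using arg_cong[OF gram_p, of "B ?x"] arg_cong[OF gram_p, of "B ?z"]
      arg_cong[OF gram_q, of "B ?x"]
      arg_cong[OF gram_p, of "B ?y"] arg_cong[OF gram_q, of "B ?z"] arg_cong[OF gram_r, of "B ?x"]
      d by (simp_all add: form lin)
  have "2 * B p p = (B p p + B r r) + (B p p + B q q) - (B q q + B r r)"
    "2 * B q q = (B q q + B r r) + (B p p + B q q) - (B p p + B r r)"
    by (simp_all add: algebra_simps)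
  then have diag: "B p p = 0" "B q q = 0"
    unfolding off by simp_all
  \<comment> \<open>The coefficients in these double brackets are Gram entries of \<open>p\<close>
    and \<open>q\<close>, all zero by now. Hence both vectors centralize \<open>?x\<close> and are
    multiples of it.\<close>
  have "bracket_sl p ?x = 0" "bracket_sl q ?x = 0"
    using off diag by (simp_all add: sl2_double_bracket trace_form_commute[of p q])
  then have "bracket_sl ?x p = 0" "bracket_sl ?x q = 0"
    by (metis neg_equal_0_iff_equal sl.bracket_commute)+
  then obtain a b where "p = scale_sl a ?x" "q = scale_sl b ?x"
    using sl2_centralizer[OF noncommuting] by blast
  then have "bracket_sl p q = 0"
    by (metis sl.bracket_scale_left sl.bracket_scale_right sl.bracket_self sl.scale_zero_right)
  then show False
    using noncommuting by contradiction
qed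

lemma bracket_orthogonal:
  "B (bracket_sl p q) p = 0" "B (bracket_sl p q) q = 0"
  by (metis sl.bracket_self trace_form_0_right trace_form_bracket trace_form_commute)+

text \<open>Both \<open>[r,q]\<close> and \<open>[p,r]\<close> are multiples of
  \<open>[p,q]\<close>, and the two factors are the coefficients of \<open>r\<close>, as in Cramer's
  rule. The remainder \<open>w\<close> commutes with \<open>p\<close> and \<open>q\<close>; were it
  nonzero, both would be multiples of it and would commute.\<close>

lemma third_in_span: "\<exists>a b. r = scale_sl a p + scale_sl b q"
proof -
  let ?x = "bracket_sl p q"
  obtain a where a: "bracket_sl r q = scale_sl a ?x"
    using sl2_bracket_in_line[OF noncommuting third_orthogonal bracket_orthogonal(2)] by blast
  obtain b where b: "bracket_sl p r = scale_sl b ?x"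
    using sl2_bracket_in_line[OF noncommuting bracket_orthogonal(1) third_orthogonal] by blast
  define w where "w = r - scale_sl a p - scale_sl b q"
  have wq: "bracket_sl w q = 0" and "bracket_sl p w = 0"
    by (simp_all add: w_def sl.bracket_diff_left sl.bracket_diff_right sl.bracket_scale_left
        sl.bracket_scale_right sl.bracket_self a b)
  then have wp: "bracket_sl w p = 0"
    by (metis neg_equal_0_iff_equal sl.bracket_commute)
  have "w = 0"
  proof (rule ccontr)
    assume "w \<noteq> 0"
    then obtain c d where "p = scale_sl c w" "q = scale_sl d w"
      using sl2_centralizer wp wq by metis
    then have "bracket_sl p q = 0"
      by (simp add: sl.bracket_scale_left sl.bracket_scale_right sl.bracket_self)
    then show False
      using noncommuting by contradiction
  qed
  then have "r = scale_sl a p + scale_sl b q"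
    by (simp add: w_def algebra_simps)
  then show ?thesis by blast
qed

text \<open>Bracketing with \<open>q\<close> or with \<open>p\<close> kills one summand and leaves a
  multiple of the nonzero vector \<open>[p,q]\<close>.\<close>

lemma independent:
  assumes "scale_sl s p + scale_sl t q = scale_sl s' p + scale_sl t' q"
  shows "s = s'" "t = t'"
proof -
  have "bracket_sl (scale_sl s p + scale_sl t q) q = bracket_sl (scale_sl s' p + scale_sl t' q) q"
    "bracket_sl p (scale_sl s p + scale_sl t q) = bracket_sl p (scale_sl s' p + scale_sl t' q)"
    by (simp_all only: assms)
  then show "s = s'" "t = t'"
    using noncommuting
    by (simp_all add: sl.bracket_add_left sl.bracket_add_right sl.bracket_scale_left
        sl.bracket_scale_right sl.bracket_self)
qed

text \<open>The left side is -2 times the Gram determinant of \<open>p\<close> and \<open>q\<close>,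
  which the relations force to vanish.\<close>

lemma bracket_isotropic: "B (bracket_sl p q) (bracket_sl p q) = 0"
proof -
  obtain a b where r: "r = scale_sl a p + scale_sl b q"
    using third_in_span by blast
  \<comment> \<open>Only the vector \<open>r\<close> is expanded here; the Gram entries involving
    \<open>r\<close> stay as unknowns.\<close>
  have "scale_sl (B q q + B r r) p + scale_sl 0 q =
      scale_sl (a * B r p) p + scale_sl (B q p + b * B r p) q"
    unfolding gram_p
    by (subst (2) r) (simp add: sl.scale_right_distrib sl.scale_left_distrib algebra_simps)
  note p = independent[OF this]
  have "scale_sl 0 p + scale_sl (B p p + B r r) q =
      scale_sl (B p q + a * B r q) p + scale_sl (b * B r q) q"
    unfolding gram_q
    by (subst (2) r) (simp add: sl.scale_right_distrib sl.scale_left_distrib algebra_simps)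
  note q = independent[OF this]
  have "B r r = a * B r p + b * B r q"
    by (subst (2) r) (simp add: trace_form_add_right trace_form_scale_right)
  then have tr: "B p p + B q q + B r r = 0"
    using p(1) q(2) by (simp add: algebra_simps)
  have pp: "B p p = - (a * B r p)"
    unfolding p(1)[symmetric] eq_neg_iff_add_eq_0 using tr by (simp only: ac_simps)
  have qq: "B q q = - (b * B r q)"
    unfolding q(2)[symmetric] eq_neg_iff_add_eq_0 using tr by (simp only: ac_simps)
  have qp: "B q p = - (b * B r p)" and pq: "B q p = - (a * B r q)"
    using p(2) q(1) by (simp_all add: eq_neg_iff_add_eq_0 trace_form_commute[of p q])
  \<comment> \<open>Multiplying the two expressions for \<open>B q p\<close> yields the product of
    the diagonal entries, so the Gram determinant is zero.\<close>
  have "B q p * B q p = - (b * B r p) * - (a * B r q)"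
    by (rule arg_cong2[OF qp pq])
  also have "\<dots> = B p p * B q q"
    unfolding pp qq by simp
  finally have "B p p * B q q = B q p * B q p" ..
  moreover have "B (bracket_sl p q) (bracket_sl p q) = B p (bracket_sl q (bracket_sl p q))"
    by (rule trace_form_bracket)
  moreover have "\<dots> = B p (scale_sl (2 * B q p) q + scale_sl (- (2 * B q q)) p)"
    by (simp add: sl2_double_bracket)
  ultimately show ?thesis
    by (simp add: trace_form_add_right trace_form_scale_right trace_form_commute[of p q]
        algebra_simps del: sl.scale_minus_left)
qed

end

text \<open>The relations are symmetric under permuting the triple, so any noncommuting pair
  \<open>u\<close>, \<open>v\<close> may come first; \<open>T\<close> is then the orthogonal
  complement of \<open>[u,v]\<close>. If all pairs commute, \<open>T\<close> is a line.\<close>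

lemma sl2_triple_in_metabelian_subalgebra:
  fixes p q r :: "('k::field_char_0, 2) sl"
  assumes rel_p: "bracket_sl q (bracket_sl q p) + bracket_sl r (bracket_sl r p) = 0"
    and rel_q: "bracket_sl p (bracket_sl p q) + bracket_sl r (bracket_sl r q) = 0"
    and rel_r: "bracket_sl p (bracket_sl p r) + bracket_sl q (bracket_sl q r) = 0"
  shows "\<exists>T x. sl.lie_subalgebra T \<and> {p, q, r} \<subseteq> T \<and>
    (\<forall>y\<in>T. \<forall>z\<in>T. bracket_sl y z \<in> sl.span {x})"
proof -
  have noncomm: ?thesis if "sl2_yang_mills_triple u v w" "{p, q, r} = {u, v, w}" for u v w
  proof -
    interpret sl2_yang_mills_triple u v w by fact
    let ?x = "bracket_sl u v"
    have "bracket_sl y z \<in> sl.span {?x}" if "B ?x y = 0" "B ?x z = 0" for y z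
      using sl2_bracket_in_line[OF noncommuting that] by (auto simp: sl.span_singleton)
    then show ?thesis
      using sl2_lie_subalgebra_orthogonal[OF noncommuting bracket_isotropic]
        third_orthogonal bracket_orthogonal that(2)
      by (intro exI[of _ "{y. B ?x y = 0}"] exI[of _ ?x]) auto
  qed
  consider "bracket_sl p q \<noteq> 0" | "bracket_sl q r \<noteq> 0" | "bracket_sl p r \<noteq> 0"
    | "bracket_sl p q = 0" "bracket_sl q r = 0" "bracket_sl p r = 0"
    by blast
  then show ?thesis
  proof cases
    case 1
    then show ?thesis
      using assms by (intro noncomm[of p q r]) (unfold_locales, auto)
  next
    case 2
    then show ?thesis
      using assms by (intro noncomm[of q r p]) (unfold_locales, auto simp: add.commute)
  next
    case 3
    then show ?thesis
      using assms by (intro noncomm[of p r q]) (unfold_locales, auto simp: add.commute)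
  next
    case 4
    then have comm: "bracket_sl u v = 0" if "u \<in> {p, q, r}" "v \<in> {p, q, r}" for u v
      using that by (auto simp: sl.bracket_self) (metis neg_equal_0_iff_equal sl.bracket_commute)+
    have "\<exists>x. {p, q, r} \<subseteq> sl.span {x}"
    proof (cases "{p, q, r} \<subseteq> {0}")
      case True
      then show ?thesis
        using sl.span_zero by blast
    next
      case False
      then obtain x where x: "x \<in> {p, q, r}" "x \<noteq> 0" by blast
      then have "{p, q, r} \<subseteq> sl.span {x}"
        using sl2_centralizer[OF x(2)] comm[OF x(1)] unfolding sl.span_singleton by blast
      then show ?thesis ..
    qed
    then obtain x where "{p, q, r} \<subseteq> sl.span {x}" ..
    then show ?thesis
      using sl.lie_subalgebra_span_singleton[of x]
      by (intro exI[of _ "sl.span {x}"] exI[of _ x]) (auto simp: sl.lie_subalgebra_def)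
  qed
qed

section \<open>Generators and homomorphisms of the Yang-Mills algebra\<close>

definition gen_ym :: "'n \<Rightarrow> ('k::field, 'n::finite) yang_mills" where
  "gen_ym i = abs_yang_mills (gen i)"

text \<open>Every element is the class of a formal Lie term under the two successive quotients, so
  structural induction on terms descends.\<close>

lemma yang_mills_induct [case_names gen zero add scale bracket]:
  fixes a :: "('k::field, 'n::finite) yang_mills"
  assumes "\<And>i. P (gen_ym i)" and "P 0"
    and "\<And>a b. P a \<Longrightarrow> P b \<Longrightarrow> P (a + b)"
    and "\<And>c a. P a \<Longrightarrow> P (scale_ym c a)"
    and "\<And>a b. P a \<Longrightarrow> P b \<Longrightarrow> P (bracket_ym a b)"
  shows "P a"
proof -
  have "P (abs_yang_mills (abs_free_lie t))" for t :: "('k, 'n) lie_term"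
    using assms
    by (induction t)
      (simp_all add: gen_ym_def flip: gen.abs_eq zero_free_lie.abs_eq plus_free_lie.abs_eq
        scale_free.abs_eq bracket_free.abs_eq zero_yang_mills.abs_eq plus_yang_mills.abs_eq
        scale_ym.abs_eq bracket_ym.abs_eq)
  then have "P (abs_yang_mills y)" for y
    by (induction y rule: free_lie.abs_induct)
  then show ?thesis
    by (induction a rule: yang_mills.abs_induct)
qed

lemma abs_yang_mills_sum:
  "abs_yang_mills (\<Sum>i\<in>A. f i) = (\<Sum>i\<in>A. abs_yang_mills (f i))"
  by (induction A rule: infinite_finite_induct)
    (simp_all flip: zero_yang_mills.abs_eq plus_yang_mills.abs_eq)

lemma yang_mills_relation:
  "(\<Sum>i\<in>UNIV. bracket_ym (gen_ym i) (bracket_ym (gen_ym i) (gen_ym j))) = 0"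
proof -
  let ?s = "\<Sum>i\<in>UNIV. bracket_free (gen i) (bracket_free (gen i) (gen j))"
  have "?s \<in> free_lie.lie_ideal_generated yang_mills_relations"
    using free_lie.lie_ideal_generated_superset by (fastforce simp: yang_mills_relations_def)
  then have "abs_yang_mills ?s = abs_yang_mills 0"
    by (simp add: yang_mills.abs_eq_iff yang_mills_cong_def)
  then show ?thesis
    by (simp add: abs_yang_mills_sum gen_ym_def bracket_ym.abs_eq zero_yang_mills.abs_eq)
qed

lemma lie_algebra_hom_range_subalgebra:
  assumes "lie_algebra_hom scale1 bracket1 scale2 bracket2 f"
  shows "lie_algebra.lie_subalgebra scale2 bracket2 (range f)"
proof -
  interpret lie_algebra_hom scale1 bracket1 scale2 bracket2 f by fact
  have "bracket2 (f a) (f b) \<in> range f" for a b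
    by (metis hom_bracket rangeI)
  then show ?thesis
    unfolding target.lie_subalgebra_def using subspace_image source.subspace_UNIV by auto
qed

text \<open>The elements mapped into \<open>T\<close> include the generators and are closed under
  all Lie operations.\<close>

lemma yang_mills_hom_range_subset:
  fixes f :: "('k::field, 'n::finite) yang_mills \<Rightarrow> 'b::ab_group_add"
  assumes "lie_algebra_hom scale_ym bracket_ym scale2 bracket2 f"
    and "lie_algebra.lie_subalgebra scale2 bracket2 T"
    and "\<And>i. f (gen_ym i) \<in> T"
  shows "range f \<subseteq> T"
proof -
  interpret lie_algebra_hom scale_ym bracket_ym scale2 bracket2 f by fact
  have T: "target.subspace T" "\<And>x y. x \<in> T \<Longrightarrow> y \<in> T \<Longrightarrow> bracket2 x y \<in> T"
    using assms(2) unfolding target.lie_subalgebra_def by auto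
  have "f a \<in> T" for a
    by (induction a rule: yang_mills_induct)
      (simp_all add: assms(3) add scale hom_bracket T target.subspace_0 target.subspace_add
        target.subspace_scale)
  then show ?thesis by blast
qed

theorem proposition2p7:
  fixes \<phi> :: "('k::{alg_closed_field, field_char_0}, 3) yang_mills \<Rightarrow> ('k, 2) sl"
  assumes "lie_algebra_hom scale_ym bracket_ym scale_sl bracket_sl \<phi>"
  shows "sl.lie_subalgebra (range \<phi>) \<and> sl.lie_solvable (range \<phi>)"
proof
  interpret lie_algebra_hom scale_ym bracket_ym scale_sl bracket_sl \<phi> by fact
  show "sl.lie_subalgebra (range \<phi>)"
    by (rule lie_algebra_hom_range_subalgebra[OF assms])
  define A where "A i = \<phi> (gen_ym i)" for i
  have "(\<Sum>i\<in>UNIV. bracket_sl (A i) (bracket_sl (A i) (A j))) = 0" for j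
    using arg_cong[OF yang_mills_relation[of j], of \<phi>]
    by (simp add: sum hom_bracket A_def)
  then have rel: "bracket_sl (A 1) (bracket_sl (A 1) (A j)) +
      bracket_sl (A 2) (bracket_sl (A 2) (A j)) + bracket_sl (A 3) (bracket_sl (A 3) (A j)) = 0" for j
    by (simp add: sum_3)
  \<comment> \<open>For each \<open>j\<close> the summand with \<open>i = j\<close> vanishes by
    \<open>sl.bracket_self\<close>, which leaves the two-term relations.\<close>
  obtain T x where T: "sl.lie_subalgebra T" "{A 1, A 2, A 3} \<subseteq> T"
      "\<forall>y\<in>T. \<forall>z\<in>T. bracket_sl y z \<in> sl.span {x}"
    using sl2_triple_in_metabelian_subalgebra[of "A 2" "A 1" "A 3"] rel[of 1] rel[of 2] rel[of 3]
    by (auto simp: sl.bracket_self)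
  have "\<forall>i. A i \<in> T"
    using T(2) by (simp add: forall_3)
  then have "range \<phi> \<subseteq> T"
    using yang_mills_hom_range_subset[OF assms T(1)] by (simp add: A_def)
  then show "sl.lie_solvable (range \<phi>)"
    using T(3) by (intro sl.lie_solvable_if_brackets_in_line[of _ x]) blast
qed

end
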